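(* Let $(M,g)$, $(N,h)$, $(Q,k)$ be Riemannian manifolds, let $\varphi:(M,g)\to(N,h)$ be a map and let $\iota:(N,h)\to(Q,k)$ be an isometric immersion. Then the composition $\iota\circ\varphi:(M,g)\to(Q,k)$ is infinity-harmonic if and only if $\varphi$ is infinity-harmonic.
   Context: Maps are assumed $C^2$. A $C^2$ map $\psi:(M,g)\to(N,h)$ between Riemannian manifolds is infinity-harmonic if $\frac12\, d\psi(\mathrm{grad}\,|d\psi|^2)=0$, where $|d\psi|_x^2=\sum_i h(d\psi(e_i),d\psi(e_i))$ for an orthonormal basis $\{e_i\}$ of $T_xM$. *)

theory Defs
  imports "HOL-Analysis.Analysis"
begin

text \<open>
  \<open>Ck_on k f S\<close> is used for open \<open>S\<close> in finite-dimensional spaces, where \<open>f\<close> is of class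
  \<open>C\<^sup>k\<close> (\<open>k \<ge> 1\<close>) iff \<open>f\<close> is differentiable and all its directional derivatives are of class
  \<open>C\<^sup>k\<^sup>-\<^sup>1\<close>.
\<close>

primrec Ck_on :: "nat \<Rightarrow> ('a::real_normed_vector \<Rightarrow> 'b::real_normed_vector) \<Rightarrow> 'a set \<Rightarrow> bool" where
  "Ck_on 0 f S \<longleftrightarrow> continuous_on S f"
| "Ck_on (Suc k) f S \<longleftrightarrow>
     (\<forall>x\<in>S. f differentiable (at x)) \<and>
     (\<forall>v. Ck_on k (\<lambda>x. frechet_derivative f (at x) v) S)"

definition smooth_on :: "('a::real_normed_vector \<Rightarrow> 'b::real_normed_vector) \<Rightarrow> 'a set \<Rightarrow> bool" where
  "smooth_on f S \<longleftrightarrow> (\<forall>k. Ck_on k f S)"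


section \<open>Manifolds\<close>

text \<open>
  A chart is a pair of a domain and a coordinate map, whose values outside the domain are
  irrelevant.  The model space is a finite-dimensional type of class \<open>real_inner\<close> rather than of
  class \<open>euclidean_space\<close>, because the latter excludes dimension 0; finiteness of the dimension is
  part of \<open>smooth_manifold\<close>, and the inner product of the model space plays no role beyond giving
  its topology.
  A tangent vector at a point is represented by the family of its coordinate representations in
  the charts around that point (and 0 in all other charts).
\<close>

type_synonym ('p, 'e) chart = "'p set \<times> ('p \<Rightarrow> 'e)"

type_synonym ('p, 'e) tvec = "('p, 'e) chart \<Rightarrow> 'e"

record ('p, 'e) rmanifold =
  mtop :: "'p topology"
  atlas :: "('p, 'e) chart set"
  metric :: "'p \<Rightarrow> ('p, 'e) tvec \<Rightarrow> ('p, 'e) tvec \<Rightarrow> real"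

abbreviation chart_inv :: "('p, 'e) chart \<Rightarrow> 'e \<Rightarrow> 'p" where
  "chart_inv c \<equiv> inv_into (fst c) (snd c)"

definition smooth_manifold :: "('p, 'e::real_inner) rmanifold \<Rightarrow> bool" where
  "smooth_manifold M \<longleftrightarrow>
     (\<exists>B. finite B \<and> span B = (UNIV :: 'e set)) \<and>
     Hausdorff_space (mtop M) \<and> second_countable (mtop M) \<and>
     (\<Union>c\<in>atlas M. fst c) = topspace (mtop M) \<and>
     (\<forall>c\<in>atlas M. openin (mtop M) (fst c) \<and> open (snd c ` fst c) \<and>
        homeomorphic_map (subtopology (mtop M) (fst c)) (top_of_set (snd c ` fst c)) (snd c)) \<and>
     (\<forall>c\<in>atlas M. \<forall>d\<in>atlas M.
        smooth_on (snd d \<circ> chart_inv c) (snd c ` (fst c \<inter> fst d)))"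

definition charts_at :: "('p, 'e) rmanifold \<Rightarrow> 'p \<Rightarrow> ('p, 'e) chart set" where
  "charts_at M p = {c \<in> atlas M. p \<in> fst c}"

definition chart_at :: "('p, 'e) rmanifold \<Rightarrow> 'p \<Rightarrow> ('p, 'e) chart" where
  "chart_at M p = (SOME c. c \<in> charts_at M p)"

definition tangent_space :: "('p, 'e::real_inner) rmanifold \<Rightarrow> 'p \<Rightarrow> ('p, 'e) tvec set" where
  "tangent_space M p =
     {v. (\<forall>c\<in>charts_at M p. \<forall>d\<in>charts_at M p.
            v d = frechet_derivative (snd d \<circ> chart_inv c) (at (snd c p)) (v c)) \<and>
         (\<forall>c. c \<notin> charts_at M p \<longrightarrow> v c = 0)}"

text \<open>The tangent vector at \<open>p\<close> whose representation in the chart \<open>c\<close> around \<open>p\<close> is \<open>u\<close>.\<close>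

definition coord_vector ::
  "('p, 'e::real_inner) rmanifold \<Rightarrow> 'p \<Rightarrow> ('p, 'e) chart \<Rightarrow> 'e \<Rightarrow> ('p, 'e) tvec" where
  "coord_vector M p c u =
     (\<lambda>d. if d \<in> charts_at M p
          then frechet_derivative (snd d \<circ> chart_inv c) (at (snd c p)) u else 0)"

definition riemannian_manifold :: "('p, 'e::real_inner) rmanifold \<Rightarrow> bool" where
  "riemannian_manifold M \<longleftrightarrow>
     smooth_manifold M \<and>
     (\<forall>p\<in>topspace (mtop M).
        (\<forall>u\<in>tangent_space M p. \<forall>v\<in>tangent_space M p. metric M p u v = metric M p v u) \<and>
        (\<forall>u\<in>tangent_space M p. \<forall>v\<in>tangent_space M p. \<forall>w\<in>tangent_space M p. \<forall>a b.
           metric M p (\<lambda>c. a *\<^sub>R u c + b *\<^sub>R v c) w = a * metric M p u w + b * metric M p v w) \<and>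
        (\<forall>u\<in>tangent_space M p. u \<noteq> (\<lambda>_. 0) \<longrightarrow> metric M p u u > 0)) \<and>
     (\<forall>c\<in>atlas M. \<forall>u w.
        smooth_on (\<lambda>y. metric M (chart_inv c y) (coord_vector M (chart_inv c y) c u)
                                             (coord_vector M (chart_inv c y) c w))
                  (snd c ` fst c))"


section \<open>Maps and their differentials\<close>

definition C2_map ::
  "('p, 'e::real_inner) rmanifold \<Rightarrow> ('q, 'f::real_inner) rmanifold \<Rightarrow> ('p \<Rightarrow> 'q) \<Rightarrow> bool" where
  "C2_map M N \<psi> \<longleftrightarrow>
     continuous_map (mtop M) (mtop N) \<psi> \<and>
     (\<forall>c\<in>atlas M. \<forall>d\<in>atlas N.
        Ck_on 2 (snd d \<circ> \<psi> \<circ> chart_inv c) (snd c ` (fst c \<inter> \<psi> -` fst d)))"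

text \<open>
  The differentials of maps and of real-valued functions are computed in one chosen chart around
  \<open>p\<close>; on tangent vectors, and for differentiable maps, they do not depend on this choice.
\<close>

definition differential ::
  "('p, 'e::real_inner) rmanifold \<Rightarrow> ('q, 'f::real_inner) rmanifold \<Rightarrow> ('p \<Rightarrow> 'q) \<Rightarrow>
   'p \<Rightarrow> ('p, 'e) tvec \<Rightarrow> ('q, 'f) tvec" where
  "differential M N \<psi> p v =
     (let c = chart_at M p in
      (\<lambda>d. if d \<in> charts_at N (\<psi> p)
           then frechet_derivative (snd d \<circ> \<psi> \<circ> chart_inv c) (at (snd c p)) (v c) else 0))"

definition differential_fun ::
  "('p, 'e::real_inner) rmanifold \<Rightarrow> ('p \<Rightarrow> real) \<Rightarrow> 'p \<Rightarrow> ('p, 'e) tvec \<Rightarrow> real" where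
  "differential_fun M f p v =
     (let c = chart_at M p in frechet_derivative (f \<circ> chart_inv c) (at (snd c p)) (v c))"

definition grad ::
  "('p, 'e::real_inner) rmanifold \<Rightarrow> ('p \<Rightarrow> real) \<Rightarrow> 'p \<Rightarrow> ('p, 'e) tvec" where
  "grad M f p =
     (THE w. w \<in> tangent_space M p \<and>
             (\<forall>v\<in>tangent_space M p. metric M p w v = differential_fun M f p v))"

definition orthonormal_basis_at ::
  "('p, 'e::real_inner) rmanifold \<Rightarrow> 'p \<Rightarrow> ('p, 'e) tvec set \<Rightarrow> bool" where
  "orthonormal_basis_at M p B \<longleftrightarrow>
     finite B \<and> B \<subseteq> tangent_space M p \<and>
     (\<forall>e\<in>B. \<forall>e'\<in>B. metric M p e e' = (if e = e' then 1 else 0)) \<and>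
     (\<forall>v\<in>tangent_space M p. \<exists>a. v = (\<lambda>c. \<Sum>e\<in>B. a e *\<^sub>R e c))"

text \<open>\<open>|d\<psi>|\<^sup>2\<close>; its value does not depend on the chosen orthonormal basis.\<close>

definition norm_differential_sq ::
  "('p, 'e::real_inner) rmanifold \<Rightarrow> ('q, 'f::real_inner) rmanifold \<Rightarrow> ('p \<Rightarrow> 'q) \<Rightarrow> 'p \<Rightarrow> real" where
  "norm_differential_sq M N \<psi> p =
     (let B = (SOME B. orthonormal_basis_at M p B) in
      \<Sum>e\<in>B. metric N (\<psi> p) (differential M N \<psi> p e) (differential M N \<psi> p e))"

definition infinity_harmonic ::
  "('p, 'e::real_inner) rmanifold \<Rightarrow> ('q, 'f::real_inner) rmanifold \<Rightarrow> ('p \<Rightarrow> 'q) \<Rightarrow> bool" where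
  "infinity_harmonic M N \<psi> \<longleftrightarrow>
     C2_map M N \<psi> \<and>
     (\<forall>p\<in>topspace (mtop M).
        (\<lambda>d. (1/2) *\<^sub>R differential M N \<psi> p (grad M (norm_differential_sq M N \<psi>) p) d) = (\<lambda>_. 0))"

definition isometric_immersion ::
  "('p, 'e::real_inner) rmanifold \<Rightarrow> ('q, 'f::real_inner) rmanifold \<Rightarrow> ('p \<Rightarrow> 'q) \<Rightarrow> bool" where
  "isometric_immersion M N \<psi> \<longleftrightarrow>
     C2_map M N \<psi> \<and>
     (\<forall>p\<in>topspace (mtop M).
        inj_on (differential M N \<psi> p) (tangent_space M p) \<and>
        (\<forall>u\<in>tangent_space M p. \<forall>v\<in>tangent_space M p.
           metric N (\<psi> p) (differential M N \<psi> p u) (differential M N \<psi> p v) = metric M p u v))"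

end

theory Submission
  imports Defs
begin

text \<open>
  Let \<open>p\<close> be a point of \<open>M\<close>.  In charts, the chain rule gives \<open>d(\<iota> \<circ> \<phi>)\<^sub>p = d\<iota> \<circ> d\<phi>\<^sub>p\<close>
  (\<open>differential_comp\<close>), and \<open>d\<phi>\<^sub>p\<close> takes values in the tangent space of \<open>N\<close> at \<open>\<phi> p\<close>
  (\<open>differential_in_tangent_space\<close>).  As \<open>d\<iota>\<close> preserves inner products of tangent vectors,
  \<open>|d(\<iota> \<circ> \<phi>)|\<^sup>2 = |d\<phi>|\<^sup>2\<close> on \<open>M\<close>, so both functions have the same gradient \<open>w\<close>.  Hence
  \<open>d(\<iota> \<circ> \<phi>)(w) = d\<iota>(d\<phi>(w))\<close>, and since \<open>d\<iota>\<close> is injective on tangent spaces and maps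
  \<open>0\<close> to \<open>0\<close>, this vanishes iff \<open>d\<phi>(w)\<close> does.

  That \<open>\<iota> \<circ> \<phi>\<close> is again of class \<open>C\<^sup>2\<close> follows from the fact that \<open>C\<^sup>k\<close> maps on open sets of
  finite-dimensional spaces compose (\<open>Ck_on_compose\<close>).

  In the representation of tangent vectors used here, a differential depends on its argument only
  through the component in one chosen chart, and its values are tangent vectors whatever the
  argument.  The identities above therefore hold for arbitrary families of components, and neither
  the existence of orthonormal bases nor that of gradients is needed.
\<close>

section \<open>Maps of class \<open>C\<^sup>k\<close>\<close>

text \<open>No differentiability is assumed: being a derivative at \<open>x\<close> is a local property.\<close>

lemma frechet_derivative_cong_open:
  assumes "open S" "x \<in> S" "\<And>y. y \<in> S \<Longrightarrow> f y = g y"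
  shows "frechet_derivative f (at x) = frechet_derivative g (at x)"
proof -
  have "(f has_derivative f') (at x) \<longleftrightarrow> (g has_derivative f') (at x)" for f'
    using has_derivative_transform_within_open[OF _ assms(1,2), of f f' UNIV g]
      has_derivative_transform_within_open[OF _ assms(1,2), of g f' UNIV f] assms(3)
    by auto
  then show ?thesis
    by (simp add: frechet_derivative_def)
qed

lemma frechet_derivative_eqI:
  "(f has_derivative f') (at x) \<Longrightarrow> frechet_derivative f (at x) = f'"
  using frechet_derivative_at by metis

lemma has_derivative_Ck_on:
  assumes "Ck_on (Suc k) f S" "x \<in> S"
  shows "(f has_derivative frechet_derivative f (at x)) (at x)"
  using assms frechet_derivative_works by auto

lemma Ck_on_cong_open:
  assumes "open S" "\<And>x. x \<in> S \<Longrightarrow> f x = g x" "Ck_on k f S"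
  shows "Ck_on k g S"
  using assms(2,3)
proof (induction k arbitrary: f g)
  case 0
  then show ?case
    by (simp cong: continuous_on_cong_simp)
next
  case (Suc k)
  have "g differentiable at x" if "x \<in> S" for x
    using has_derivative_transform_within_open[OF has_derivative_Ck_on[OF Suc.prems(2) that]
        assms(1) that] Suc.prems(1) differentiableI by blast
  moreover have "Ck_on k (\<lambda>x. frechet_derivative g (at x) v) S" for v
  proof (rule Suc.IH)
    show "frechet_derivative f (at x) v = frechet_derivative g (at x) v" if "x \<in> S" for x
      using frechet_derivative_cong_open[OF assms(1) that, of f g] Suc.prems(1) by simp
    show "Ck_on k (\<lambda>x. frechet_derivative f (at x) v) S"
      using Suc.prems(2) by simp
  qed
  ultimately show ?case
    by simp
qed

lemma Ck_on_subset: "Ck_on k f S \<Longrightarrow> T \<subseteq> S \<Longrightarrow> Ck_on k f T"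
  by (induction k arbitrary: f) (auto intro: continuous_on_subset)

lemma Ck_on_locally:
  assumes "\<And>x. x \<in> S \<Longrightarrow> \<exists>T. open T \<and> x \<in> T \<and> Ck_on k f T"
  shows "Ck_on k f S"
  using assms
proof (induction k arbitrary: f)
  case 0
  have "isCont f x" if "x \<in> S" for x
    using 0[OF that] continuous_on_eq_continuous_at by auto
  then show ?case
    by (simp add: continuous_at_imp_continuous_on)
next
  case (Suc k)
  have "f differentiable at x" if "x \<in> S" for x
    using Suc.prems[OF that] by auto
  moreover have "Ck_on k (\<lambda>x. frechet_derivative f (at x) v) S" for v
    by (rule Suc.IH) (use Suc.prems in fastforce)
  ultimately show ?case
    by simp
qed

lemma Ck_on_Suc_imp: "Ck_on (Suc k) f S \<Longrightarrow> Ck_on k f S"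
proof (induction k arbitrary: f)
  case 0
  then show ?case
    by (simp add: continuous_at_imp_continuous_on differentiable_imp_continuous_within)
qed simp

lemma Ck_on_derivativeI:
  assumes "open S"
    and "\<And>x. x \<in> S \<Longrightarrow> (f has_derivative f' x) (at x)"
    and "\<And>v. Ck_on k (\<lambda>x. f' x v) S"
  shows "Ck_on (Suc k) f S"
proof -
  have "Ck_on k (\<lambda>x. frechet_derivative f (at x) v) S" for v
    by (rule Ck_on_cong_open[OF assms(1) _ assms(3)[of v]])
      (simp add: frechet_derivative_eqI[OF assms(2)])
  then show ?thesis
    using assms(2) by (auto simp: differentiable_def)
qed

lemma Ck_on_const: "open S \<Longrightarrow> Ck_on k (\<lambda>_. c) S"
proof (induction k arbitrary: c)
  case (Suc k)
  show ?case
    by (rule Ck_on_derivativeI[OF Suc.prems has_derivative_const Suc.IH[OF Suc.prems]])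
qed simp

lemma Ck_on_add:
  assumes "open S" "Ck_on k f S" "Ck_on k g S"
  shows "Ck_on k (\<lambda>x. f x + g x) S"
  using assms(2,3)
proof (induction k arbitrary: f g)
  case 0
  then show ?case
    by (simp add: continuous_on_add)
next
  case (Suc k)
  show ?case
  proof (rule Ck_on_derivativeI[OF assms(1)])
    show "((\<lambda>x. f x + g x) has_derivative
      (\<lambda>v. frechet_derivative f (at x) v + frechet_derivative g (at x) v)) (at x)"
      if "x \<in> S" for x
      by (rule has_derivative_add) (use Suc.prems that has_derivative_Ck_on in blast)+
    show "Ck_on k (\<lambda>x. frechet_derivative f (at x) v + frechet_derivative g (at x) v) S" for v
      using Suc by simp
  qed
qed

lemma Ck_on_sum:
  assumes "open S" "\<And>i. i \<in> I \<Longrightarrow> Ck_on k (f i) S"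
  shows "Ck_on k (\<lambda>x. \<Sum>i\<in>I. f i x) S"
  using assms(2)
  by (induction I rule: infinite_finite_induct) (auto intro: Ck_on_const Ck_on_add assms(1))

lemma Ck_on_bounded_linear:
  assumes "open S" "bounded_linear L" "Ck_on k f S"
  shows "Ck_on k (\<lambda>x. L (f x)) S"
  using assms(3)
proof (induction k arbitrary: f)
  case 0
  then show ?case
    by (simp add: bounded_linear.continuous_on[OF assms(2)])
next
  case (Suc k)
  show ?case
  proof (rule Ck_on_derivativeI[OF assms(1)])
    show "((\<lambda>x. L (f x)) has_derivative (\<lambda>v. L (frechet_derivative f (at x) v))) (at x)"
      if "x \<in> S" for x
      by (rule bounded_linear.has_derivative[OF assms(2) has_derivative_Ck_on[OF Suc.prems that]])
    show "Ck_on k (\<lambda>x. L (frechet_derivative f (at x) v)) S" for v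
      using Suc by simp
  qed
qed

lemma Ck_on_scaleR:
  assumes "open S" "Ck_on k a S" "Ck_on k f S"
  shows "Ck_on k (\<lambda>x. a x *\<^sub>R f x) S"
  using assms(2,3)
proof (induction k arbitrary: a f)
  case 0
  then show ?case
    by (simp add: continuous_on_scaleR)
next
  case (Suc k)
  show ?case
  proof (rule Ck_on_derivativeI[OF assms(1)])
    show "((\<lambda>x. a x *\<^sub>R f x) has_derivative
      (\<lambda>v. a x *\<^sub>R frechet_derivative f (at x) v + frechet_derivative a (at x) v *\<^sub>R f x)) (at x)"
      if "x \<in> S" for x
      by (rule has_derivative_scaleR) (use Suc.prems that has_derivative_Ck_on in blast)+
    show "Ck_on k (\<lambda>x. a x *\<^sub>R frechet_derivative f (at x) v +
        frechet_derivative a (at x) v *\<^sub>R f x) S" for v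
      using Suc.prems Ck_on_Suc_imp[OF Suc.prems(1)] Ck_on_Suc_imp[OF Suc.prems(2)]
      by (intro Ck_on_add assms(1) Suc.IH) auto
  qed
qed

text \<open>
  \<open>C\<close> is an orthogonal spanning set.  It may contain \<open>0\<close>, which contributes nothing to the sum.
\<close>

lemma finite_dim_orthogonal_expansion:
  fixes B :: "'a::real_inner set"
  assumes "finite B" "span B = UNIV"
  obtains C :: "'a set" where "finite C" "\<And>u. u = (\<Sum>b\<in>C. (u \<bullet> b / (b \<bullet> b)) *\<^sub>R b)"
proof -
  obtain C where C: "finite C" "span C = (UNIV :: 'a set)" "pairwise orthogonal C"
    using basis_orthogonal[OF assms(1)] assms(2) by metis
  have "u = (\<Sum>b\<in>C. (u \<bullet> b / (b \<bullet> b)) *\<^sub>R b)" for u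
  proof -
    define w where "w = u - (\<Sum>b\<in>C. (b \<bullet> u / (b \<bullet> b)) *\<^sub>R b)"
    have "orthogonal w y" if "y \<in> C" for y
    proof -
      have "(\<Sum>b\<in>C. (b \<bullet> u / (b \<bullet> b)) * (b \<bullet> y)) =
          (\<Sum>b\<in>C. if b = y then y \<bullet> u else 0)"
        using C(3) that by (intro sum.cong refl) (simp add: pairwise_def orthogonal_def)
      also have "\<dots> = u \<bullet> y"
        using C(1) that by (simp add: inner_commute)
      finally show ?thesis
        by (simp add: w_def orthogonal_def inner_diff_left inner_sum_left)
    qed
    then have "orthogonal w w"
      using orthogonal_to_span[of w C w] C(2) by auto
    then show ?thesis
      by (simp add: w_def orthogonal_def inner_commute)
  qed
  with C(1) show thesis
    by (rule that)
qed

text \<open>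
  The derivative of \<open>g \<circ> h\<close> in direction \<open>v\<close> is \<open>x \<mapsto> Dg(h x)(Dh(x) v)\<close>.
  For \<open>g\<close> of class \<open>C\<^sup>k\<close>, only the functions \<open>y \<mapsto> Dg(y) b\<close> for fixed \<open>b\<close> are known to be of class \<open>C\<^sup>k\<^sup>-\<^sup>1\<close>, so \<open>Dh(x) v\<close> is expanded in
  a basis of the intermediate space, which is where finite dimension enters.
\<close>

lemma Ck_on_compose:
  fixes h :: "'a::real_normed_vector \<Rightarrow> 'b::real_inner" and g :: "'b \<Rightarrow> 'c::real_normed_vector"
  assumes fin: "finite B" "span B = (UNIV :: 'b set)"
    and opens: "open S" "open T" and hST: "h ` S \<subseteq> T"
    and "Ck_on k h S" "Ck_on k g T"
  shows "Ck_on k (g \<circ> h) S"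
  using assms(6,7)
proof (induction k arbitrary: g)
  case 0
  then show ?case
    using continuous_on_compose[of S h g] continuous_on_subset[OF _ hST]
    unfolding Ck_on.simps by blast
next
  case (Suc k)
  obtain C :: "'b set" where C: "finite C" "\<And>u. u = (\<Sum>b\<in>C. (u \<bullet> b / (b \<bullet> b)) *\<^sub>R b)"
    using finite_dim_orthogonal_expansion[OF fin] by metis
  let ?Dg = "\<lambda>x. frechet_derivative g (at (h x))"
  let ?Dh = "\<lambda>x. frechet_derivative h (at x)"
  show ?case
  proof (rule Ck_on_derivativeI[OF opens(1)])
    fix x assume x: "x \<in> S"
    then have "h x \<in> T"
      using hST by auto
    have lin: "linear (?Dg x)"
      using has_derivative_linear[OF has_derivative_Ck_on[OF Suc.prems(2) \<open>h x \<in> T\<close>]] .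
    have "?Dg x \<circ> ?Dh x = (\<lambda>v. \<Sum>b\<in>C. (?Dh x v \<bullet> b / (b \<bullet> b)) *\<^sub>R ?Dg x b)"
    proof
      fix v
      have "?Dg x (?Dh x v) = ?Dg x (\<Sum>b\<in>C. (?Dh x v \<bullet> b / (b \<bullet> b)) *\<^sub>R b)"
        using C(2)[of "?Dh x v"] by simp
      then show "(?Dg x \<circ> ?Dh x) v = (\<Sum>b\<in>C. (?Dh x v \<bullet> b / (b \<bullet> b)) *\<^sub>R ?Dg x b)"
        by (simp add: linear_sum[OF lin] linear_cmul[OF lin])
    qed
    then show "(g \<circ> h has_derivative
        (\<lambda>v. \<Sum>b\<in>C. (?Dh x v \<bullet> b / (b \<bullet> b)) *\<^sub>R ?Dg x b)) (at x)"
      using diff_chain_at[OF has_derivative_Ck_on[OF Suc.prems(1) x]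
          has_derivative_Ck_on[OF Suc.prems(2) \<open>h x \<in> T\<close>]] by simp
  next
    fix v
    show "Ck_on k (\<lambda>x. \<Sum>b\<in>C. (?Dh x v \<bullet> b / (b \<bullet> b)) *\<^sub>R ?Dg x b) S"
    proof (intro Ck_on_sum Ck_on_scaleR opens(1))
      fix b :: 'b
      have bl: "bounded_linear (\<lambda>u. u \<bullet> b / (b \<bullet> b))"
        using bounded_linear_compose[OF bounded_linear_divide bounded_linear_inner_left] .
      show "Ck_on k (\<lambda>x. ?Dh x v \<bullet> b / (b \<bullet> b)) S"
        using Ck_on_bounded_linear[OF opens(1) bl] Suc.prems(1) by simp
      have "Ck_on k ((\<lambda>y. frechet_derivative g (at y) b) \<circ> h) S"
        by (rule Suc.IH[OF Ck_on_Suc_imp[OF Suc.prems(1)]]) (use Suc.prems(2) in simp)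
      then show "Ck_on k (\<lambda>x. ?Dg x b) S"
        by (simp add: o_def)
    qed
  qed
qed


section \<open>Charts\<close>

lemma chart_inj_on: "smooth_manifold M \<Longrightarrow> c \<in> atlas M \<Longrightarrow> inj_on (snd c) (fst c)"
  and chart_openin: "smooth_manifold M \<Longrightarrow> c \<in> atlas M \<Longrightarrow> openin (mtop M) (fst c)"
proof -
  assume M: "smooth_manifold M" "c \<in> atlas M"
  then show op: "openin (mtop M) (fst c)"
    by (auto simp: smooth_manifold_def)
  have "homeomorphic_map (subtopology (mtop M) (fst c)) (top_of_set (snd c ` fst c)) (snd c)"
    using M by (auto simp: smooth_manifold_def)
  then show "inj_on (snd c) (fst c)"
    using homeomorphic_imp_injective_map openin_subset[OF op] topspace_subtopology_subset
    by metis
qed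

lemma chart_inv_inverse:
  "smooth_manifold M \<Longrightarrow> c \<in> atlas M \<Longrightarrow> p \<in> fst c \<Longrightarrow> chart_inv c (snd c p) = p"
  using chart_inj_on inv_into_f_f by metis

lemma open_chart_image:
  assumes "smooth_manifold M" "c \<in> atlas M" "openin (mtop M) U" "U \<subseteq> fst c"
  shows "open (snd c ` U)"
proof -
  have c: "homeomorphic_map (subtopology (mtop M) (fst c)) (top_of_set (snd c ` fst c)) (snd c)"
    "open (snd c ` fst c)"
    using assms by (auto simp: smooth_manifold_def)
  have "openin (subtopology (mtop M) (fst c)) U"
    using assms(3,4) by (simp add: openin_open_subtopology chart_openin[OF assms(1,2)])
  then have "openin (top_of_set (snd c ` fst c)) (snd c ` U)"
    using homeomorphic_imp_open_map[OF c(1)] by (auto simp: open_map_def)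
  then show ?thesis
    using openin_open_eq[OF c(2)] by auto
qed

lemma charts_cover:
  assumes "smooth_manifold M" "p \<in> topspace (mtop M)"
  obtains c where "c \<in> charts_at M p"
proof -
  have "p \<in> (\<Union>c\<in>atlas M. fst c)"
    using assms unfolding smooth_manifold_def by blast
  then show thesis
    using that by (auto simp: charts_at_def)
qed

lemma chart_at_in_charts_at:
  "smooth_manifold M \<Longrightarrow> p \<in> topspace (mtop M) \<Longrightarrow> chart_at M p \<in> charts_at M p"
  unfolding chart_at_def by (rule charts_cover) (auto intro: someI)

lemma openin_preimage_in_chart:
  assumes "smooth_manifold M" "c \<in> atlas M" "continuous_map (mtop M) (mtop N) \<phi>"
    "openin (mtop N) V"
  shows "openin (mtop M) (fst c \<inter> \<phi> -` V)"
proof -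
  have "fst c \<inter> \<phi> -` V = fst c \<inter> {x \<in> topspace (mtop M). \<phi> x \<in> V}"
    using openin_subset[OF chart_openin[OF assms(1,2)]] by auto
  then show ?thesis
    using openin_Int[OF chart_openin[OF assms(1,2)]
        openin_continuous_map_preimage[OF assms(3,4)]] by simp
qed

lemma C2_map_continuous: "C2_map M N \<phi> \<Longrightarrow> continuous_map (mtop M) (mtop N) \<phi>"
  by (simp add: C2_map_def)

lemma C2_map_differentiable:
  assumes "smooth_manifold M" "C2_map M N \<phi>" "c \<in> charts_at M p" "d \<in> charts_at N (\<phi> p)"
  shows "(snd d \<circ> \<phi> \<circ> chart_inv c) differentiable at (snd c p)"
proof -
  have "Ck_on 2 (snd d \<circ> \<phi> \<circ> chart_inv c) (snd c ` (fst c \<inter> \<phi> -` fst d))"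
    using assms by (auto simp: C2_map_def charts_at_def)
  then show ?thesis
    using assms by (auto simp: charts_at_def eval_nat_numeral)
qed

lemma transition_differentiable:
  assumes "smooth_manifold M" "c \<in> charts_at M p" "d \<in> charts_at M p"
  shows "(snd d \<circ> chart_inv c) differentiable at (snd c p)"
proof -
  have "smooth_on (snd d \<circ> chart_inv c) (snd c ` (fst c \<inter> fst d))"
    using assms by (auto simp: smooth_manifold_def charts_at_def)
  then have "Ck_on (Suc 0) (snd d \<circ> chart_inv c) (snd c ` (fst c \<inter> fst d))"
    unfolding smooth_on_def by blast
  then show ?thesis
    using assms by (auto simp: charts_at_def)
qed

text \<open>
  Chain rule for a function \<open>g\<close> on \<open>N\<close> with values in a normed space.  It is used for charts of
  \<open>N\<close> and for the components of a map out of \<open>N\<close>.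
\<close>

lemma frechet_derivative_through_chart:
  assumes M: "smooth_manifold M" and N: "smooth_manifold N" and \<phi>: "C2_map M N \<phi>"
    and c: "c \<in> charts_at M p" and e: "e \<in> charts_at N (\<phi> p)"
    and g: "(g \<circ> chart_inv e) differentiable at (snd e (\<phi> p))"
  shows "frechet_derivative (g \<circ> \<phi> \<circ> chart_inv c) (at (snd c p)) v =
    frechet_derivative (g \<circ> chart_inv e) (at (snd e (\<phi> p)))
      (frechet_derivative (snd e \<circ> \<phi> \<circ> chart_inv c) (at (snd c p)) v)"
proof -
  have cA: "c \<in> atlas M" "p \<in> fst c" and eA: "e \<in> atlas N" "\<phi> p \<in> fst e"
    using c e by (auto simp: charts_at_def)
  let ?U = "fst c \<inter> \<phi> -` fst e"
  let ?h = "snd e \<circ> \<phi> \<circ> chart_inv c"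
  have U: "open (snd c ` ?U)" "snd c p \<in> snd c ` ?U"
    using open_chart_image[OF M cA(1)] cA eA
      openin_preimage_in_chart[OF M cA(1) C2_map_continuous[OF \<phi>] chart_openin[OF N eA(1)]]
    by auto
  have eq: "(g \<circ> \<phi> \<circ> chart_inv c) y = ((g \<circ> chart_inv e) \<circ> ?h) y" if "y \<in> snd c ` ?U" for y
    using that chart_inv_inverse[OF M cA(1)] chart_inv_inverse[OF N eA(1)] by auto
  have hp: "?h (snd c p) = snd e (\<phi> p)"
    using chart_inv_inverse[OF M cA] by simp
  have "(?h has_derivative frechet_derivative ?h (at (snd c p))) (at (snd c p))"
    using C2_map_differentiable[OF M \<phi> c e] frechet_derivative_works by blast
  moreover have "((g \<circ> chart_inv e) has_derivative
      frechet_derivative (g \<circ> chart_inv e) (at (snd e (\<phi> p)))) (at (?h (snd c p)))"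
    using g frechet_derivative_works unfolding hp by blast
  ultimately have "frechet_derivative ((g \<circ> chart_inv e) \<circ> ?h) (at (snd c p)) =
      frechet_derivative (g \<circ> chart_inv e) (at (snd e (\<phi> p))) \<circ>
      frechet_derivative ?h (at (snd c p))"
    by (intro frechet_derivative_eqI diff_chain_at)
  then show ?thesis
    by (subst frechet_derivative_cong_open[OF U eq]) simp_all
qed


section \<open>Composition of maps between manifolds\<close>

text \<open>The vector \<open>v\<close> need not be tangent to \<open>M\<close>, here and in \<open>differential_comp\<close>.\<close>

lemma differential_in_tangent_space:
  assumes "smooth_manifold M" "smooth_manifold N" "C2_map M N \<phi>" "p \<in> topspace (mtop M)"
  shows "differential M N \<phi> p v \<in> tangent_space N (\<phi> p)"
proof -
  let ?c = "chart_at M p"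
  have "differential M N \<phi> p v d =
      frechet_derivative (snd d \<circ> chart_inv e) (at (snd e (\<phi> p))) (differential M N \<phi> p v e)"
    if e: "e \<in> charts_at N (\<phi> p)" and d: "d \<in> charts_at N (\<phi> p)" for e d
    using frechet_derivative_through_chart[OF assms(1-3) chart_at_in_charts_at[OF assms(1,4)] e
        transition_differentiable[OF assms(2) e d], of "v ?c"] e d
    by (simp add: differential_def Let_def)
  moreover have "differential M N \<phi> p v d = 0" if "d \<notin> charts_at N (\<phi> p)" for d
    using that by (simp add: differential_def Let_def)
  ultimately show ?thesis
    unfolding tangent_space_def by blast
qed

lemma differential_comp:
  assumes "smooth_manifold M" "smooth_manifold N" "C2_map M N \<phi>" "C2_map N Q \<iota>"
    "p \<in> topspace (mtop M)"
  shows "differential M Q (\<iota> \<circ> \<phi>) p v = differential N Q \<iota> (\<phi> p) (differential M N \<phi> p v)"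
proof -
  have "\<phi> p \<in> topspace (mtop N)"
    using C2_map_continuous[OF assms(3)] assms(5) by (auto simp: continuous_map_def)
  then have e: "chart_at N (\<phi> p) \<in> charts_at N (\<phi> p)"
    by (rule chart_at_in_charts_at[OF assms(2)])
  have "frechet_derivative (snd d \<circ> (\<iota> \<circ> \<phi>) \<circ> chart_inv (chart_at M p))
        (at (snd (chart_at M p) p)) (v (chart_at M p)) =
      frechet_derivative (snd d \<circ> \<iota> \<circ> chart_inv (chart_at N (\<phi> p)))
        (at (snd (chart_at N (\<phi> p)) (\<phi> p)))
        (frechet_derivative (snd (chart_at N (\<phi> p)) \<circ> \<phi> \<circ> chart_inv (chart_at M p))
          (at (snd (chart_at M p) p)) (v (chart_at M p)))"
    if "d \<in> charts_at Q (\<iota> (\<phi> p))" for d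
    unfolding comp_assoc[of "snd d" \<iota> \<phi>, symmetric]
    by (rule frechet_derivative_through_chart[OF assms(1-3) chart_at_in_charts_at[OF assms(1,5)] e
        C2_map_differentiable[OF assms(2,4) e that]])
  then show ?thesis
    using e by (auto simp: differential_def Let_def)
qed

lemma zero_in_tangent_space:
  assumes "smooth_manifold M"
  shows "(\<lambda>_. 0) \<in> tangent_space M p"
  using linear_0[OF linear_frechet_derivative[OF transition_differentiable[OF assms]]]
  by (simp add: tangent_space_def)

lemma differential_zero:
  assumes "smooth_manifold M" "C2_map M N \<phi>" "p \<in> topspace (mtop M)"
  shows "differential M N \<phi> p (\<lambda>_. 0) = (\<lambda>_. 0)"
  using linear_0[OF linear_frechet_derivative[OF
        C2_map_differentiable[OF assms(1,2) chart_at_in_charts_at[OF assms(1,3)]]]]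
  by (auto simp: differential_def Let_def)

lemma C2_map_comp:
  fixes N :: "('b, 'n::real_inner) rmanifold"
  assumes M: "smooth_manifold M" and N: "smooth_manifold N" and Q: "smooth_manifold Q"
    and \<phi>: "C2_map M N \<phi>" and \<iota>: "C2_map N Q \<iota>"
  shows "C2_map M Q (\<iota> \<circ> \<phi>)"
proof -
  obtain B :: "'n set" where B: "finite B" "span B = (UNIV :: 'n set)"
    using N by (auto simp: smooth_manifold_def)
  have cont: "continuous_map (mtop M) (mtop Q) (\<iota> \<circ> \<phi>)"
    using C2_map_continuous[OF \<phi>] C2_map_continuous[OF \<iota>] by (rule continuous_map_compose)
  have "Ck_on 2 (snd d \<circ> (\<iota> \<circ> \<phi>) \<circ> chart_inv c) (snd c ` (fst c \<inter> (\<iota> \<circ> \<phi>) -` fst d))"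
    if c: "c \<in> atlas M" and d: "d \<in> atlas Q" for c d
  proof (rule Ck_on_locally)
    fix x assume "x \<in> snd c ` (fst c \<inter> (\<iota> \<circ> \<phi>) -` fst d)"
    then obtain p where p: "p \<in> fst c" "\<iota> (\<phi> p) \<in> fst d" and x: "x = snd c p"
      by auto
    have "p \<in> topspace (mtop M)"
      using p openin_subset[OF chart_openin[OF M c]] by auto
    then have "\<phi> p \<in> topspace (mtop N)"
      using C2_map_continuous[OF \<phi>] by (auto simp: continuous_map_def)
    then obtain e where e: "e \<in> atlas N" "\<phi> p \<in> fst e"
      by (rule charts_cover[OF N]) (auto simp: charts_at_def)
    let ?V = "fst e \<inter> \<iota> -` fst d"
    let ?U = "fst c \<inter> \<phi> -` ?V"
    have V: "openin (mtop N) ?V"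
      by (rule openin_preimage_in_chart[OF N e(1) C2_map_continuous[OF \<iota>] chart_openin[OF Q d]])
    have U: "openin (mtop M) ?U"
      by (rule openin_preimage_in_chart[OF M c C2_map_continuous[OF \<phi>] V])
    have opens: "open (snd c ` ?U)" "open (snd e ` ?V)"
      using open_chart_image[OF M c U] open_chart_image[OF N e(1) V] by auto
    have "Ck_on 2 ((snd d \<circ> \<iota> \<circ> chart_inv e) \<circ> (snd e \<circ> \<phi> \<circ> chart_inv c)) (snd c ` ?U)"
    proof (rule Ck_on_compose[OF B opens])
      show "(snd e \<circ> \<phi> \<circ> chart_inv c) ` snd c ` ?U \<subseteq> snd e ` ?V"
        using chart_inv_inverse[OF M c] by auto
      have "Ck_on 2 (snd e \<circ> \<phi> \<circ> chart_inv c) (snd c ` (fst c \<inter> \<phi> -` fst e))"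
        using \<phi> c e(1) by (auto simp: C2_map_def)
      then show "Ck_on 2 (snd e \<circ> \<phi> \<circ> chart_inv c) (snd c ` ?U)"
        by (rule Ck_on_subset) auto
      show "Ck_on 2 (snd d \<circ> \<iota> \<circ> chart_inv e) (snd e ` ?V)"
        using \<iota> e(1) d by (auto simp: C2_map_def)
    qed
    then have "Ck_on 2 (snd d \<circ> (\<iota> \<circ> \<phi>) \<circ> chart_inv c) (snd c ` ?U)"
      by (rule Ck_on_cong_open[OF opens(1), rotated])
        (auto simp: chart_inv_inverse[OF M c] chart_inv_inverse[OF N e(1)])
    moreover have "x \<in> snd c ` ?U"
      using p e x by auto
    ultimately show "\<exists>T. open T \<and> x \<in> T \<and> Ck_on 2 (snd d \<circ> (\<iota> \<circ> \<phi>) \<circ> chart_inv c) T"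
      using opens(1) by blast
  qed
  with cont show ?thesis
    by (auto simp: C2_map_def)
qed


section \<open>Isometric immersions and the infinity-harmonic equation\<close>

text \<open>
  The functions need to agree only on \<open>M\<close>: the gradient at \<open>p\<close> involves their values in a chart
  domain around \<open>p\<close>.
\<close>

lemma grad_cong:
  assumes M: "smooth_manifold M" and p: "p \<in> topspace (mtop M)"
    and fg: "\<And>q. q \<in> topspace (mtop M) \<Longrightarrow> f q = g q"
  shows "grad M f p = grad M g p"
proof -
  let ?c = "chart_at M p"
  have c: "?c \<in> atlas M" "p \<in> fst ?c"
    using chart_at_in_charts_at[OF M p] by (auto simp: charts_at_def)
  have op: "openin (mtop M) (fst ?c)"
    by (rule chart_openin[OF M c(1)])
  have "open (snd ?c ` fst ?c)" "snd ?c p \<in> snd ?c ` fst ?c"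
    using open_chart_image[OF M c(1) op] c(2) by auto
  moreover have "(f \<circ> chart_inv ?c) y = (g \<circ> chart_inv ?c) y" if "y \<in> snd ?c ` fst ?c" for y
    using that fg openin_subset[OF op] chart_inv_inverse[OF M c(1)] by auto
  ultimately have "frechet_derivative (f \<circ> chart_inv ?c) (at (snd ?c p)) =
      frechet_derivative (g \<circ> chart_inv ?c) (at (snd ?c p))"
    by (rule frechet_derivative_cong_open)
  then show ?thesis
    by (simp add: grad_def differential_fun_def Let_def)
qed

lemma norm_differential_sq_isometric_immersion:
  assumes "smooth_manifold M" "smooth_manifold N" "C2_map M N \<phi>" "isometric_immersion N Q \<iota>"
    "p \<in> topspace (mtop M)"
  shows "norm_differential_sq M Q (\<iota> \<circ> \<phi>) p = norm_differential_sq M N \<phi> p"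
proof -
  have \<iota>: "C2_map N Q \<iota>"
    using assms(4) by (simp add: isometric_immersion_def)
  have "\<phi> p \<in> topspace (mtop N)"
    using C2_map_continuous[OF assms(3)] assms(5) by (auto simp: continuous_map_def)
  then have "metric Q (\<iota> (\<phi> p)) (differential M Q (\<iota> \<circ> \<phi>) p v) (differential M Q (\<iota> \<circ> \<phi>) p v) =
      metric N (\<phi> p) (differential M N \<phi> p v) (differential M N \<phi> p v)" for v
    using assms(4) differential_in_tangent_space[OF assms(1-3,5)]
    by (simp add: isometric_immersion_def differential_comp[OF assms(1-3) \<iota> assms(5)])
  then show ?thesis
    by (simp add: norm_differential_sq_def)
qed

theorem proposition4p2:
  fixes M :: "('a, 'm::real_inner) rmanifold"
    and N :: "('b, 'n::real_inner) rmanifold"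
    and Q :: "('c, 'q::real_inner) rmanifold"
    and \<phi> :: "'a \<Rightarrow> 'b" and \<iota> :: "'b \<Rightarrow> 'c"
  assumes "riemannian_manifold M"
    and "riemannian_manifold N"
    and "riemannian_manifold Q"
    and "C2_map M N \<phi>"
    and "isometric_immersion N Q \<iota>"
  shows "infinity_harmonic M Q (\<iota> \<circ> \<phi>) \<longleftrightarrow> infinity_harmonic M N \<phi>"
proof -
  have M: "smooth_manifold M" and N: "smooth_manifold N" and Q: "smooth_manifold Q"
    using assms by (auto simp: riemannian_manifold_def)
  have \<iota>: "C2_map N Q \<iota>"
    using assms(5) by (simp add: isometric_immersion_def)
  have "differential M Q (\<iota> \<circ> \<phi>) p (grad M (norm_differential_sq M Q (\<iota> \<circ> \<phi>)) p) = (\<lambda>_. 0) \<longleftrightarrow>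
      differential M N \<phi> p (grad M (norm_differential_sq M N \<phi>) p) = (\<lambda>_. 0)"
    if p: "p \<in> topspace (mtop M)" for p
  proof -
    let ?w = "grad M (norm_differential_sq M N \<phi>) p"
    have \<phi>p: "\<phi> p \<in> topspace (mtop N)"
      using C2_map_continuous[OF assms(4)] p by (auto simp: continuous_map_def)
    have grad: "grad M (norm_differential_sq M Q (\<iota> \<circ> \<phi>)) p = ?w"
      by (rule grad_cong[OF M p norm_differential_sq_isometric_immersion[OF M N assms(4,5)]])
    have inj: "inj_on (differential N Q \<iota> (\<phi> p)) (tangent_space N (\<phi> p))"
      using assms(5) \<phi>p by (auto simp: isometric_immersion_def)
    have "differential N Q \<iota> (\<phi> p) (differential M N \<phi> p ?w) = differential N Q \<iota> (\<phi> p) (\<lambda>_. 0) \<longleftrightarrow>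
        differential M N \<phi> p ?w = (\<lambda>_. 0)"
      by (rule inj_on_eq_iff[OF inj differential_in_tangent_space[OF M N assms(4) p]
            zero_in_tangent_space[OF N]])
    then show ?thesis
      by (simp add: grad differential_comp[OF M N assms(4) \<iota> p] differential_zero[OF N \<iota> \<phi>p])
  qed
  then show ?thesis
    using assms(4) C2_map_comp[OF M N Q assms(4) \<iota>]
    by (simp add: infinity_harmonic_def fun_eq_iff)
qed

end
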